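(* Let $\mathcal{S}$ be an additive commutative semi-group with zero element $0$, and let $I:\mathcal{S}\to\mathcal{S}$ be an additive involution ($I^2=\mathrm{Id}$) such that $I(0)=0$. Define the equivalence relation $\sim_{\mathcal{O}}$ on $\mathcal{S}$ by: $u\sim_{\mathcal{O}}v$ if and only if there exist $u_0,u_1\in\mathcal{S}$ such that, with $\xi_0=u_0+I(u_0)$ and $\xi_1=u_1+I(u_1)$, $$u+\xi_0=v+\xi_1 .$$ Then: (i) the equivalence relation $\sim_{\mathcal{O}}$ is compatible with the addition in $\mathcal{S}$; (ii) $\mathcal{S}/\sim_{\mathcal{O}}$ is a group; (iii) denoting by $[u]$ the $\sim_{\mathcal{O}}$-equivalence class of $u$, one has $-[u]=[I(u)]$.
   Context: A commutative semi-group with zero means a commutative monoid written additively. Additive means $I(u+v)=I(u)+I(v)$. *)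

theory Defs
  imports "HOL-Algebra.Group"
begin

(* The semigroup is written multiplicatively, following HOL-Algebra: the operation, zero
   and negation of the additive notation are the mult, one and m_inv of the record. *)

definition sim_O :: "('a, 'b) monoid_scheme \<Rightarrow> ('a \<Rightarrow> 'a) \<Rightarrow> ('a \<times> 'a) set" where
  "sim_O G I = {(u, v). u \<in> carrier G \<and> v \<in> carrier G \<and>
     (\<exists>u0 \<in> carrier G. \<exists>u1 \<in> carrier G.
        u \<otimes>\<^bsub>G\<^esub> (u0 \<otimes>\<^bsub>G\<^esub> I u0) = v \<otimes>\<^bsub>G\<^esub> (u1 \<otimes>\<^bsub>G\<^esub> I u1))}"

definition class_O :: "('a, 'b) monoid_scheme \<Rightarrow> ('a \<Rightarrow> 'a) \<Rightarrow> 'a \<Rightarrow> 'a set" where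
  "class_O G I u = sim_O G I `` {u}"

(* The product of two classes is the union of the classes of all products of representatives;
   it is a single class, independent of the representatives, exactly because the relation is
   compatible with the operation. *)
definition quotient_O :: "('a, 'b) monoid_scheme \<Rightarrow> ('a \<Rightarrow> 'a) \<Rightarrow> 'a set monoid" where
  "quotient_O G I =
     \<lparr>carrier = carrier G // sim_O G I,
      mult = (\<lambda>A B. \<Union>a\<in>A. \<Union>b\<in>B. class_O G I (a \<otimes>\<^bsub>G\<^esub> b)),
      one = class_O G I \<one>\<^bsub>G\<^esub>\<rparr>"

end

theory Submission
  imports Defs
begin

text \<open>
  Call \<open>\<xi> u = u \<otimes> I u\<close> the trace of \<open>u\<close>. As \<open>I\<close> is a homomorphism and \<open>G\<close> is
  commutative, \<open>\<xi>\<close> is a homomorphism too, so the traces form a submonoid of \<open>G\<close>, and two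
  elements are related exactly when they become equal after multiplication by suitable traces.
  For any submonoid of a commutative monoid such a relation is a congruence: multiplying two
  witnessing equations multiplies their traces. Hence the quotient is a commutative
  monoid (lemmas \<open>equiv_sim_O\<close>, \<open>sim_O_mult\<close>, \<open>class_O_mult\<close>).

  What is particular to traces is that \<open>u \<otimes> I u\<close> is itself a trace and so is related to
  \<open>\<one>\<close> (lemma \<open>sim_O_trace_one\<close>). Therefore the class of \<open>I u\<close> is an inverse of the class of
  \<open>u\<close>, and the quotient is a group with the asserted negation.
\<close>

locale comm_monoid_endomorphism = comm_monoid G for G (structure) +
  fixes I :: "'a \<Rightarrow> 'a"
  assumes I_hom: "I \<in> hom G G"
    and I_one: "I \<one> = \<one>"
begin

lemma I_closed [simp, intro]: "u \<in> carrier G \<Longrightarrow> I u \<in> carrier G"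
  using I_hom by (rule hom_in_carrier)

lemma I_mult: "\<lbrakk>u \<in> carrier G; v \<in> carrier G\<rbrakk> \<Longrightarrow> I (u \<otimes> v) = I u \<otimes> I v"
  using I_hom by (rule hom_mult)

definition trace :: "'a \<Rightarrow> 'a" where
  "trace u = u \<otimes> I u"

lemma trace_closed [simp, intro]: "u \<in> carrier G \<Longrightarrow> trace u \<in> carrier G"
  by (simp add: trace_def)

lemma trace_one: "trace \<one> = \<one>"
  by (simp add: trace_def I_one)

lemma trace_mult:
  assumes "u \<in> carrier G" "v \<in> carrier G"
  shows "trace (u \<otimes> v) = trace u \<otimes> trace v"
  using assms by (simp add: trace_def I_mult m_ac)

lemma sim_O_iff:
  "(u, v) \<in> sim_O G I \<longleftrightarrow> u \<in> carrier G \<and> v \<in> carrier G \<and>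
     (\<exists>s \<in> carrier G. \<exists>t \<in> carrier G. u \<otimes> trace s = v \<otimes> trace t)"
  by (simp add: sim_O_def trace_def)

lemma sim_O_I:
  assumes "u \<in> carrier G" "v \<in> carrier G" "s \<in> carrier G" "t \<in> carrier G"
    and "u \<otimes> trace s = v \<otimes> trace t"
  shows "(u, v) \<in> sim_O G I"
  using assms by (auto simp: sim_O_iff)

lemma sim_O_E:
  assumes "(u, v) \<in> sim_O G I"
  obtains s t where "u \<in> carrier G" "v \<in> carrier G" "s \<in> carrier G" "t \<in> carrier G"
    "u \<otimes> trace s = v \<otimes> trace t"
  using assms by (auto simp: sim_O_iff)

text \<open>
  For transitivity, from \<open>u \<otimes> \<xi> s = v \<otimes> \<xi> t\<close> and \<open>v \<otimes> \<xi> p = w \<otimes> \<xi> q\<close> the middle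
  element \<open>v\<close> cannot be cancelled; instead both sides are brought to the common value
  \<open>v \<otimes> \<xi> t \<otimes> \<xi> p\<close>.
\<close>

lemma equiv_sim_O: "equiv (carrier G) (sim_O G I)"
proof (rule equivI)
  show "sim_O G I \<subseteq> carrier G \<times> carrier G"
    by (auto simp: sim_O_iff)
  show "refl_on (carrier G) (sim_O G I)"
    by (rule refl_onI) (auto intro: sim_O_I)
  show "sym (sim_O G I)"
    by (rule symI) (metis sim_O_E sim_O_I)
  show "trans (sim_O G I)"
  proof (rule transI)
    fix u v w
    assume "(u, v) \<in> sim_O G I" and "(v, w) \<in> sim_O G I"
    then obtain s t p q where c: "u \<in> carrier G" "v \<in> carrier G" "w \<in> carrier G"
        "s \<in> carrier G" "t \<in> carrier G" "p \<in> carrier G" "q \<in> carrier G"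
      and st: "u \<otimes> trace s = v \<otimes> trace t" and pq: "v \<otimes> trace p = w \<otimes> trace q"
      by (metis sim_O_E)
    have "u \<otimes> trace (s \<otimes> p) = (u \<otimes> trace s) \<otimes> trace p"
      using c by (simp add: trace_mult m_assoc)
    also have "\<dots> = (v \<otimes> trace p) \<otimes> trace t"
      unfolding st using c by (simp add: m_ac)
    also have "\<dots> = w \<otimes> trace (q \<otimes> t)"
      unfolding pq using c by (simp add: trace_mult m_assoc)
    finally show "(u, w) \<in> sim_O G I"
      using c by (intro sim_O_I[of u w "s \<otimes> p" "q \<otimes> t"]) auto
  qed
qed

lemma sim_O_mult:
  assumes "(u, u') \<in> sim_O G I" and "(v, v') \<in> sim_O G I"
  shows "(u \<otimes> v, u' \<otimes> v') \<in> sim_O G I"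
proof -
  obtain s t p q where c: "u \<in> carrier G" "u' \<in> carrier G" "v \<in> carrier G" "v' \<in> carrier G"
      "s \<in> carrier G" "t \<in> carrier G" "p \<in> carrier G" "q \<in> carrier G"
    and st: "u \<otimes> trace s = u' \<otimes> trace t" and pq: "v \<otimes> trace p = v' \<otimes> trace q"
    using assms by (metis sim_O_E)
  have "(u \<otimes> v) \<otimes> trace (s \<otimes> p) = (u \<otimes> trace s) \<otimes> (v \<otimes> trace p)"
    using c by (simp add: trace_mult m_ac)
  also have "\<dots> = (u' \<otimes> v') \<otimes> trace (t \<otimes> q)"
    unfolding st pq using c by (simp add: trace_mult m_ac)
  finally show ?thesis
    using c by (intro sim_O_I[of _ _ "s \<otimes> p" "t \<otimes> q"]) auto
qed

text \<open>
  The witnessing equation is \<open>\<xi> u \<otimes> \<xi> \<one> = \<one> \<otimes> \<xi> u\<close>, with \<open>\<xi> \<one> = \<one>\<close> as the trivial multiplier.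
\<close>

lemma sim_O_trace_one:
  assumes "u \<in> carrier G"
  shows "(u \<otimes> I u, \<one>) \<in> sim_O G I"
  using assms by (intro sim_O_I[of _ _ \<one> u]) (auto simp: trace_one, simp add: trace_def)

lemma class_O_eqI: "(u, v) \<in> sim_O G I \<Longrightarrow> class_O G I u = class_O G I v"
  unfolding class_O_def by (rule equiv_class_eq[OF equiv_sim_O])

lemma carrier_quotient_O: "carrier (quotient_O G I) = class_O G I ` carrier G"
  by (auto simp: quotient_O_def class_O_def quotient_def)

lemma one_quotient_O: "\<one>\<^bsub>quotient_O G I\<^esub> = class_O G I \<one>"
  by (simp add: quotient_O_def)

text \<open>
  By compatibility all the classes in the union that defines the product coincide, and the
  union is not empty because a class contains its representative.
\<close>

lemma class_O_mult:
  assumes "u \<in> carrier G" "v \<in> carrier G"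
  shows "class_O G I u \<otimes>\<^bsub>quotient_O G I\<^esub> class_O G I v = class_O G I (u \<otimes> v)"
proof -
  have const: "class_O G I (a \<otimes> b) = class_O G I (u \<otimes> v)"
    if "a \<in> class_O G I u" "b \<in> class_O G I v" for a b
    using that by (intro class_O_eqI[symmetric] sim_O_mult) (simp_all add: class_O_def)
  have ne: "u \<in> class_O G I u" "v \<in> class_O G I v"
    using assms equiv_class_self[OF equiv_sim_O] by (auto simp: class_O_def)
  have "(\<Union>a\<in>class_O G I u. \<Union>b\<in>class_O G I v. class_O G I (a \<otimes> b)) = class_O G I (u \<otimes> v)"
  proof (intro equalityI UN_least)
    show "class_O G I (u \<otimes> v)
        \<subseteq> (\<Union>a\<in>class_O G I u. \<Union>b\<in>class_O G I v. class_O G I (a \<otimes> b))"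
      using ne by blast
  qed (simp add: const)
  then show ?thesis
    by (simp add: quotient_O_def)
qed

lemma class_O_I_mult:
  assumes "u \<in> carrier G"
  shows "class_O G I (I u) \<otimes>\<^bsub>quotient_O G I\<^esub> class_O G I u = \<one>\<^bsub>quotient_O G I\<^esub>"
  using assms sim_O_trace_one[OF assms]
  by (simp add: class_O_mult one_quotient_O m_comm[of "I u" u] class_O_eqI)

lemma comm_group_quotient_O: "comm_group (quotient_O G I)"
proof (rule comm_groupI)
  fix A B assume "A \<in> carrier (quotient_O G I)" "B \<in> carrier (quotient_O G I)"
  then obtain u v where "u \<in> carrier G" "v \<in> carrier G" "A = class_O G I u" "B = class_O G I v"
    by (auto simp: carrier_quotient_O)
  then show "A \<otimes>\<^bsub>quotient_O G I\<^esub> B = B \<otimes>\<^bsub>quotient_O G I\<^esub> A"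
    by (simp add: class_O_mult m_comm[of u v])
next
  fix A assume "A \<in> carrier (quotient_O G I)"
  then obtain u where u: "u \<in> carrier G" "A = class_O G I u"
    by (auto simp: carrier_quotient_O)
  then show "\<exists>B \<in> carrier (quotient_O G I). B \<otimes>\<^bsub>quotient_O G I\<^esub> A = \<one>\<^bsub>quotient_O G I\<^esub>"
    by (intro bexI[of _ "class_O G I (I u)"]) (auto simp: class_O_I_mult carrier_quotient_O)
qed (auto simp: carrier_quotient_O one_quotient_O class_O_mult m_assoc)

lemma inv_class_O:
  assumes "u \<in> carrier G"
  shows "inv\<^bsub>quotient_O G I\<^esub> (class_O G I u) = class_O G I (I u)"
proof -
  interpret Q: comm_group "quotient_O G I"
    by (rule comm_group_quotient_O)
  show ?thesis
    using assms by (intro Q.inv_equality class_O_I_mult) (auto simp: carrier_quotient_O)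
qed

end

theorem proposition27:
  fixes G :: "('a, 'b) monoid_scheme" (structure)
    and I :: "'a \<Rightarrow> 'a"
  assumes "comm_monoid G"
    and "I \<in> hom G G"
    and "\<And>u. u \<in> carrier G \<Longrightarrow> I (I u) = u"
    and "I \<one> = \<one>"
  shows "equiv (carrier G) (sim_O G I)
    \<and> (\<forall>u u' v v'. (u, u') \<in> sim_O G I \<longrightarrow> (v, v') \<in> sim_O G I
          \<longrightarrow> (u \<otimes> v, u' \<otimes> v') \<in> sim_O G I)
    \<and> group (quotient_O G I)
    \<and> (\<forall>u \<in> carrier G. inv\<^bsub>quotient_O G I\<^esub> (class_O G I u) = class_O G I (I u))"
proof -
  interpret comm_monoid_endomorphism G I
    using assms by (intro comm_monoid_endomorphism.intro comm_monoid_endomorphism_axioms.intro) auto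
  show ?thesis
    using equiv_sim_O sim_O_mult comm_group.axioms(2)[OF comm_group_quotient_O] inv_class_O
    by blast
qed

end
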